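(* Let $q\in(0,1)$, $s=1-q$, let $T_0$ be a positive-integer-valued, almost surely finite random variable with probability generating function $g$, and let $T$ be the completion time of the task with base time $T_0$ under memoryless catastrophe with rate $q$. Put $p=g(s)$, $D_k=g^{(k)}(s)$, and \[ N(w)=(1-ws)\,g(ws),\qquad D(w)=1-w+qw\,g(ws), \] so that $G_T(w)=E[w^T]=N(w)/D(w)$. Define $\Delta_k=N^{(k)}(1)-D^{(k)}(1)$ for $k\ge 1$. Then \[ \Delta_k=\begin{cases}1-p, & k=1,\\ -k\,s^{k-1}\,D_{k-1}, & k\ge 2.\end{cases} \] In particular, $\Delta_k$ does not contain $D_k=g^{(k)}(s)$. Consequently, for every $k\ge1$ and fixed $q$, the $k$-th factorial moment $E[T(T-1)\cdots(T-k+1)]$ of $T$ depends on $T_0$ only through the $(k-1)$-jet $\{g(s),g'(s),\dots,g^{(k-1)}(s)\}$ (that is, two base times $T_0$ with the same $(k-1)$-jet at $s$ give the same $k$-th factorial moment of $T$), never on $g^{(k)}(s)$.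
   Context: The probability generating function (PGF) of $T_0$ is $g(z)=E[z^{T_0}]=\sum_{t\ge1}P(T_0=t)z^t$. Memoryless catastrophe with rate $q$: at each step, independently of everything else, a catastrophe occurs with probability $q$; if it occurs before the base task has completed, all progress is destroyed and the process restarts from scratch with a fresh independent copy of $T_0$; the process terminates at the first step at which no catastrophe occurs and the base task completes. Formally, attempts $i=1,2,\dots$ are independent; attempt $i$ has a copy $T_0^{(i)}$ of $T_0$ and an independent random variable $\tau_i$ with $P(\tau_i>t)=s^t$, $t=0,1,2,\dots$; it succeeds iff $T_0^{(i)}<\tau_i$, and it lasts $\min(T_0^{(i)},\tau_i)$ steps. The completion time $T$ is the total length of all attempts up to and including the first successful one. The success probability of an attempt is $p=g(s)$. *)

theory Defs
  imports "HOL-Probability.Probability"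
begin

text \<open>
  A base time enters only through its law, a \<open>nat pmf\<close> \<open>P\<close>; that it is positive is the condition
  \<open>0 \<notin> set_pmf P\<close>. Outside the disc of convergence the Bochner integral below is \<open>0\<close> by
  convention; for \<open>\<bar>z\<bar> \<le> 1\<close> it is the usual power series.
\<close>

definition pgf :: "nat pmf \<Rightarrow> real \<Rightarrow> real" where
  "pgf P z = measure_pmf.expectation P (\<lambda>t. z ^ t)"

text \<open>
  Attempts are numbered from \<open>0\<close>. The family indexed by the sum type \<open>nat + nat\<close> lists all copies
  \<open>T0 i\<close> and all catastrophe times \<open>tau i\<close>, so \<open>indep\<close> is their joint independence.
\<close>

locale memoryless_catastrophe = prob_space M
  for M :: "'a measure" +
  fixes q :: real
    and P :: "nat pmf"
    and T0 tau :: "nat \<Rightarrow> 'a \<Rightarrow> nat"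
  assumes indep: "indep_vars (\<lambda>_. count_space UNIV) (case_sum T0 tau) UNIV"
    and T0_law: "\<And>i. distr M (count_space UNIV) (T0 i) = measure_pmf P"
    and tau_tail: "\<And>i t. prob {\<omega> \<in> space M. tau i \<omega> > t} = (1 - q) ^ t"

text \<open>
  The value \<open>0\<close> in the absence of a successful attempt is a convention on a null set: in the model
  each attempt succeeds with probability \<open>pgf P (1 - q) > 0\<close>, independently of the others.
\<close>

definition completion_time ::
    "(nat \<Rightarrow> 'a \<Rightarrow> nat) \<Rightarrow> (nat \<Rightarrow> 'a \<Rightarrow> nat) \<Rightarrow> 'a \<Rightarrow> nat" where
  "completion_time T0 tau \<omega> =
     (if \<exists>i. T0 i \<omega> < tau i \<omega>
      then \<Sum>i \<le> (LEAST i. T0 i \<omega> < tau i \<omega>). min (T0 i \<omega>) (tau i \<omega>)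
      else 0)"

definition N_fun :: "real \<Rightarrow> nat pmf \<Rightarrow> real \<Rightarrow> real" where
  "N_fun q P w = (1 - w * (1 - q)) * pgf P (w * (1 - q))"

definition D_fun :: "real \<Rightarrow> nat pmf \<Rightarrow> real \<Rightarrow> real" where
  "D_fun q P w = 1 - w + q * w * pgf P (w * (1 - q))"

definition Delta :: "real \<Rightarrow> nat pmf \<Rightarrow> nat \<Rightarrow> real" where
  "Delta q P k = (deriv ^^ k) (N_fun q P) 1 - (deriv ^^ k) (D_fun q P) 1"

definition falling_factorial :: "nat \<Rightarrow> nat \<Rightarrow> real" where
  "falling_factorial k n = (\<Prod>j<k. real n - real j)"

definition same_jet :: "nat \<Rightarrow> real \<Rightarrow> (real \<Rightarrow> real) \<Rightarrow> (real \<Rightarrow> real) \<Rightarrow> bool" where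
  "same_jet m s f g \<longleftrightarrow> (\<forall>j\<le>m. (deriv ^^ j) f s = (deriv ^^ j) g s)"

end

theory Submission
  imports Defs
begin

text \<open>
  Conditioning on the base time, one attempt contributes \<open>g(ws)\<close> to the generating function if it
  succeeds and \<open>a(w) = qw (1 - g(ws)) / (1 - ws)\<close> if it fails, so summing over the index of the
  first success gives \<open>G = g(ws) / (1 - a(w)) = N / D\<close>. This holds for \<open>\<bar>w\<bar> < 1 / (1 - qp)\<close>, a disc
  of radius larger than \<open>1\<close>, whence the factorial moments are \<open>k!\<close> times the coefficients of \<open>G\<close> in
  powers of \<open>w - 1\<close>.

  Everything else rests on the identity \<open>N - D = (1 - w) (g(ws) - 1)\<close>: it yields \<open>\<Delta>\<^sub>k\<close> at once, and
  since \<open>(G - 1) D = N - D\<close> the factor \<open>1 - w\<close> removes one derivative of \<open>g\<close> from the \<open>k\<close>-th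
  coefficient of \<open>G\<close>.
\<close>

subsection \<open>Power series expansions and derivatives\<close>

lemma has_fps_expansion_higher_deriv:
  fixes f :: "'a :: {banach, real_normed_field} \<Rightarrow> 'a"
  assumes "f has_fps_expansion F"
  shows "(deriv ^^ n) f has_fps_expansion (fps_deriv ^^ n) F"
  using assms by (induction n) (auto intro: has_fps_expansion_deriv)

text \<open>The n-fold derivative has an expansion whose constant term is
  \<open>fact n * fps_nth F n\<close>. The shift moves \<open>z\<close> to 0, the point that
  \<open>has_fps_expansion\<close> refers to.\<close>

lemma higher_deriv_eq_fps_nth:
  fixes f :: "'a :: {banach, real_normed_field} \<Rightarrow> 'a"
  assumes "(\<lambda>x. f (z + x)) has_fps_expansion F"
  shows "(deriv ^^ n) f z = fact n * fps_nth F n"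
proof -
  have "(deriv ^^ n) (\<lambda>x. f (z + x)) has_fps_expansion (fps_deriv ^^ n) F"
    using assms by (rule has_fps_expansion_higher_deriv)
  then have "eval_fps ((fps_deriv ^^ n) F) 0 = (deriv ^^ n) (\<lambda>x. f (z + x)) 0"
    unfolding has_fps_expansion_def by (auto dest: eventually_nhds_x_imp_x)
  then show ?thesis
    by (subst higher_deriv_shift_0) (simp add: eval_fps_at_0 fps_0th_higher_deriv o_def)
qed

lemma has_fps_expansion_unique:
  fixes f :: "'a :: {banach, real_normed_field} \<Rightarrow> 'a"
  assumes "f has_fps_expansion F" "f has_fps_expansion G"
  shows "F = G"
proof (rule fps_ext)
  fix n
  have "fact n * fps_nth F n = fact n * fps_nth G n"
    using assms higher_deriv_eq_fps_nth[of f 0] by (metis (no_types, lifting) ext add_0)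
  then show "fps_nth F n = fps_nth G n" by simp
qed

section \<open>Expectations of powers and binomial moments\<close>

lemma falling_factorial_eq: "falling_factorial k n = fact k * real (n choose k)"
  unfolding falling_factorial_def
  by (simp add: binomial_gbinomial gbinomial_mult_fact atLeast0LessThan)

lemma integrable_power_mono:
  fixes T :: "'a \<Rightarrow> nat" and R z :: real
  assumes T: "T \<in> measurable M (count_space UNIV)"
    and R: "integrable M (\<lambda>\<omega>. R ^ T \<omega>)" and z: "\<bar>z\<bar> \<le> R"
  shows "integrable M (\<lambda>\<omega>. z ^ T \<omega>)"
  by (rule Bochner_Integration.integrable_bound[OF R measurable_compose[OF T]])
     (use z in \<open>auto simp: power_abs intro!: power_mono\<close>)

context
  fixes M :: "'a measure" and T :: "'a \<Rightarrow> nat" and R z :: real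
  assumes T: "T \<in> measurable M (count_space UNIV)"
    and R: "integrable M (\<lambda>\<omega>. R ^ T \<omega>)" and z: "0 \<le> z"
begin

text \<open>All summands are nonnegative, so truncating the binomial expansion of
  \<open>(z + y) ^ t\<close> can only lower it. The bound is uniform in \<open>n\<close>: it
  dominates a single term and also controls the partial sums of the series of norms in
  \<open>integral_power_sums\<close>.\<close>

lemma binomial_partial_sum_le:
  fixes y :: real
  assumes "0 \<le> y" "z + y \<le> R"
  shows "(\<Sum>k<n. real (t choose k) * z ^ (t - k) * y ^ k) \<le> R ^ t"
proof -
  have "(\<Sum>k<n. real (t choose k) * z ^ (t - k) * y ^ k)
      \<le> (\<Sum>k\<in>{..<n} \<union> {..t}. real (t choose k) * z ^ (t - k) * y ^ k)"
    using assms z by (intro sum_mono2) auto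
  also have "\<dots> = (\<Sum>k\<le>t. real (t choose k) * z ^ (t - k) * y ^ k)"
    by (intro sum.mono_neutral_right) (auto simp: binomial_eq_0)
  also have "\<dots> = (y + z) ^ t"
    by (subst binomial_ring) (simp add: mult_ac)
  also have "\<dots> \<le> R ^ t"
    using assms z by (intro power_mono) auto
  finally show ?thesis .
qed

lemma integrable_binomial_term:
  assumes "z + \<bar>y\<bar> \<le> R"
  shows "integrable M (\<lambda>\<omega>. real (T \<omega> choose k) * z ^ (T \<omega> - k) * y ^ k)"
proof (rule Bochner_Integration.integrable_bound[OF R])
  show "(\<lambda>\<omega>. real (T \<omega> choose k) * z ^ (T \<omega> - k) * y ^ k) \<in> borel_measurable M"
    by (rule measurable_compose[OF T]) simp
  show "AE \<omega> in M. norm (real (T \<omega> choose k) * z ^ (T \<omega> - k) * y ^ k) \<le> norm (R ^ T \<omega>)"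
  proof (rule AE_I2)
    fix \<omega>
    have "real (T \<omega> choose k) * z ^ (T \<omega> - k) * \<bar>y\<bar> ^ k
        \<le> (\<Sum>k<Suc k. real (T \<omega> choose k) * z ^ (T \<omega> - k) * \<bar>y\<bar> ^ k)"
      using z by (simp add: sum_nonneg)
    also have "\<dots> \<le> R ^ T \<omega>"
      using assms by (intro binomial_partial_sum_le) auto
    also have "\<dots> \<le> \<bar>R ^ T \<omega>\<bar>"
      by (rule abs_ge_self)
    finally show "norm (real (T \<omega> choose k) * z ^ (T \<omega> - k) * y ^ k) \<le> norm (R ^ T \<omega>)"
      using z by (simp add: abs_mult power_abs)
  qed
qed

lemma integrable_binomial:
  assumes "z < R"
  shows "integrable M (\<lambda>\<omega>. real (T \<omega> choose k) * z ^ (T \<omega> - k))"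
  \<comment> \<open>With \<open>y = R - z\<close> positive, the constant factor \<open>y ^ k\<close>
    cancels.\<close>
  using integrable_binomial_term[of "R - z" k] assms by simp

text \<open>Pointwise this is the binomial theorem, with finitely many nonzero terms. Sum and
  integral may be exchanged because the norms are the same terms at \<open>\<bar>y\<bar>\<close>,
  whose partial sums integrate to at most the expectation of \<open>R ^ T\<close>.\<close>

lemma integral_power_sums:
  assumes y: "z + \<bar>y\<bar> \<le> R"
  shows "(\<lambda>k. (\<integral>\<omega>. real (T \<omega> choose k) * z ^ (T \<omega> - k) \<partial>M) * y ^ k)
           sums (\<integral>\<omega>. (z + y) ^ T \<omega> \<partial>M)"
proof -
  let ?f = "\<lambda>k \<omega>. real (T \<omega> choose k) * z ^ (T \<omega> - k) * y ^ k"
  have abs_f: "norm (?f k \<omega>) = real (T \<omega> choose k) * z ^ (T \<omega> - k) * \<bar>y\<bar> ^ k" for k \<omega>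
    using z by (simp add: abs_mult power_abs)
  have fin: "norm (?f k \<omega>) = 0" if "k \<notin> {..T \<omega>}" for k \<omega>
    using that by (simp add: binomial_eq_0)
  have "(\<lambda>k. \<integral>\<omega>. ?f k \<omega> \<partial>M) sums (\<integral>\<omega>. (\<Sum>k. ?f k \<omega>) \<partial>M)"
  proof (rule sums_integral)
    show "integrable M (?f k)" for k
      using y by (rule integrable_binomial_term)
    show "AE \<omega> in M. summable (\<lambda>k. norm (?f k \<omega>))"
      using fin by (intro AE_I2) (rule summable_finite[OF finite_atMost])
    show "summable (\<lambda>k. \<integral>\<omega>. norm (?f k \<omega>) \<partial>M)"
    proof (rule bounded_imp_summable)
      fix n
      have "(\<Sum>k\<le>n. \<integral>\<omega>. norm (?f k \<omega>) \<partial>M) = (\<integral>\<omega>. (\<Sum>k<Suc n. norm (?f k \<omega>)) \<partial>M)"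
        unfolding lessThan_Suc_atMost
        by (rule Bochner_Integration.integral_sum[symmetric])
           (rule integrable_norm, rule integrable_binomial_term[OF y])
      also have "\<dots> \<le> (\<integral>\<omega>. R ^ T \<omega> \<partial>M)"
        unfolding abs_f
        by (intro integral_mono R binomial_partial_sum_le Bochner_Integration.integrable_sum
              integrable_binomial_term) (use y in auto)
      finally show "(\<Sum>k\<le>n. \<integral>\<omega>. norm (?f k \<omega>) \<partial>M) \<le> (\<integral>\<omega>. R ^ T \<omega> \<partial>M)" .
    qed auto
  qed
  moreover have "(\<Sum>k. ?f k \<omega>) = (z + y) ^ T \<omega>" for \<omega>
  proof -
    have "(\<Sum>k. ?f k \<omega>) = (\<Sum>k\<le>T \<omega>. ?f k \<omega>)"
      by (intro suminf_finite) (auto simp: binomial_eq_0)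
    also have "\<dots> = (y + z) ^ T \<omega>"
      by (subst binomial_ring) (simp add: mult_ac)
    finally show ?thesis by (simp add: add.commute)
  qed
  ultimately show ?thesis by simp
qed

text \<open>The strict bound \<open>z < R\<close> leaves a neighbourhood of 0 on which
  \<open>integral_power_sums\<close> applies. The scale \<open>c\<close> is kept general: 1 reads
  off derivatives at \<open>z\<close>, while \<open>c = z\<close> expands in the relative variable
  \<open>x\<close> of \<open>z * (1 + x)\<close>.\<close>

lemma integral_power_has_fps_expansion:
  assumes "z < R"
  shows "(\<lambda>x. \<integral>\<omega>. (z + c * x) ^ T \<omega> \<partial>M) has_fps_expansion
           Abs_fps (\<lambda>k. (\<integral>\<omega>. real (T \<omega> choose k) * z ^ (T \<omega> - k) \<partial>M) * c ^ k)"
proof (rule has_fps_expansionI)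
  have "((\<lambda>x. \<bar>c * x\<bar>) \<longlongrightarrow> \<bar>c * 0\<bar>) (nhds 0)"
    by (intro tendsto_intros filterlim_ident)
  then have "\<forall>\<^sub>F x in nhds 0. \<bar>c * x\<bar> < R - z"
    using assms by (intro order_tendstoD) auto
  then show "\<forall>\<^sub>F x in nhds 0. (\<lambda>k. fps_nth (Abs_fps (\<lambda>k.
      (\<integral>\<omega>. real (T \<omega> choose k) * z ^ (T \<omega> - k) \<partial>M) * c ^ k)) k * x ^ k) sums (\<integral>\<omega>. (z + c * x) ^ T \<omega> \<partial>M)"
  proof eventually_elim
    case (elim x)
    then show ?case
      using integral_power_sums[of "c * x"] by (simp add: power_mult_distrib mult.assoc)
  qed
qed

end

section \<open>Expansions of g(ws), N and D about w = 1, and the quotient N/D\<close>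

definition pgf_fps :: "nat pmf \<Rightarrow> real \<Rightarrow> real fps" where
  "pgf_fps P s = Abs_fps (\<lambda>k. (deriv ^^ k) (pgf P) s / fact k * s ^ k)"

text \<open>Scale 1 identifies the binomial moments with the derivatives of g at \<open>s\<close>;
  scale \<open>s\<close> then gives the expansion, with \<open>s ^ k\<close> from the chain rule.
  Writing the coefficients through derivatives turns agreement of jets into agreement of
  coefficients.\<close>

lemma pgf_has_fps_expansion:
  assumes "0 \<le> s" "s < 1"
  shows "(\<lambda>x. pgf P ((1 + x) * s)) has_fps_expansion pgf_fps P s"
proof -
  let ?E = "\<lambda>c. Abs_fps (\<lambda>k. (\<integral>t. real (t choose k) * s ^ (t - k) \<partial>measure_pmf P) * c ^ k)"
  have exp: "(\<lambda>x. pgf P (s + c * x)) has_fps_expansion ?E c" for c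
    unfolding pgf_def
    using integral_power_has_fps_expansion[of "\<lambda>t. t" "measure_pmf P" 1 s c] assms by simp
  have "(deriv ^^ k) (pgf P) s = fact k * (\<integral>t. real (t choose k) * s ^ (t - k) \<partial>measure_pmf P)" for k
    using higher_deriv_eq_fps_nth[of "pgf P" s "?E 1" k] exp[of 1] by simp
  then have "?E s = pgf_fps P s"
    by (simp add: pgf_fps_def)
  with exp[of s] show ?thesis
    by (simp add: algebra_simps)
qed

text \<open>In the following two definitions \<open>A\<close> is the expansion of \<open>g(ws)\<close> in \<open>X = w - 1\<close>.\<close>

definition N_fps :: "real \<Rightarrow> real fps \<Rightarrow> real fps" where
  "N_fps q A = (1 - (1 + fps_X) * fps_const (1 - q)) * A"

definition D_fps :: "real \<Rightarrow> real fps \<Rightarrow> real fps" where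
  "D_fps q A = fps_const q * (1 + fps_X) * A - fps_X"

lemma N_fps_minus_D_fps: "N_fps q A - D_fps q A = - (fps_X * (A - 1))"
proof -
  have "fps_const (1 - q) = 1 - fps_const q"
    by (metis fps_const_1_eq_1 fps_const_sub)
  then show ?thesis
    unfolding N_fps_def D_fps_def by algebra
qed

lemma N_fun_has_fps_expansion:
  assumes "0 < q" "q < 1"
  shows "(\<lambda>x. N_fun q P (1 + x)) has_fps_expansion N_fps q (pgf_fps P (1 - q))"
  unfolding N_fun_def N_fps_def
  by (intro fps_expansion_intros pgf_has_fps_expansion) (use assms in auto)

lemma D_fun_has_fps_expansion:
  assumes "0 < q" "q < 1"
  shows "(\<lambda>x. D_fun q P (1 + x)) has_fps_expansion D_fps q (pgf_fps P (1 - q))"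
proof -
  \<comment> \<open>For \<open>w = 1 + x\<close> the part \<open>1 - w\<close> of
    \<open>D_fun\<close> is \<open>- x\<close>.\<close>
  have "(\<lambda>x. q * (1 + x) * pgf P ((1 + x) * (1 - q)) - x) has_fps_expansion
      D_fps q (pgf_fps P (1 - q))"
    unfolding D_fps_def
    by (intro fps_expansion_intros pgf_has_fps_expansion) (use assms in auto)
  then show ?thesis
    by (simp add: D_fun_def)
qed

lemma Delta_eq:
  assumes q: "0 < q" "q < 1" and k: "1 \<le> k"
  shows "Delta q P k =
    (if k = 1 then 1 - pgf P (1 - q)
     else - real k * (1 - q) ^ (k - 1) * (deriv ^^ (k - 1)) (pgf P) (1 - q))"
proof -
  obtain m where m: "k = Suc m" using k by (cases k) auto
  let ?A = "pgf_fps P (1 - q)"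
  have "Delta q P k = fact k * fps_nth (N_fps q ?A - D_fps q ?A) k"
    unfolding Delta_def
    using higher_deriv_eq_fps_nth[OF N_fun_has_fps_expansion[OF q]]
      higher_deriv_eq_fps_nth[OF D_fun_has_fps_expansion[OF q]]
    by (simp add: right_diff_distrib)
  \<comment> \<open>The factor \<open>fps_X\<close> lowers the index from \<open>k\<close> to
    \<open>m\<close>, so the derivative of order \<open>k\<close> drops out. Against the
    \<open>fact m\<close> in \<open>pgf_fps\<close>, \<open>fact (Suc m)\<close> leaves the factor
    \<open>k\<close>.\<close>
  also have "\<dots> = - (fact (Suc m) * fps_nth (?A - 1) m)"
    unfolding N_fps_minus_D_fps m by (simp add: algebra_simps)
  also have "fact (Suc m) * fps_nth (?A - 1) m = (if m = 0 then pgf P (1 - q) - 1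
      else real (Suc m) * ((1 - q) ^ m * (deriv ^^ m) (pgf P) (1 - q)))"
    by (simp add: pgf_fps_def)
  finally show ?thesis
    by (auto simp: m algebra_simps)
qed

text \<open>
  With \<open>F\<^sub>i = N\<^sub>i / D\<^sub>i\<close> one has \<open>(F\<^sub>i - 1) D\<^sub>i = - X (A\<^sub>i - 1)\<close>, and cross-multiplying the two
  equations makes \<open>F\<^sub>1 - F\<^sub>2\<close> divisible by \<open>X (A\<^sub>1 - A\<^sub>2)\<close>.
\<close>

lemma quotient_fps_nth_cong:
  fixes A B F G :: "real fps"
  assumes F: "F * D_fps q A = N_fps q A" and G: "G * D_fps q B = N_fps q B"
    and nz: "q \<noteq> 0" "fps_nth A 0 \<noteq> 0" "fps_nth B 0 \<noteq> 0"
    and eq: "\<And>j. j < k \<Longrightarrow> fps_nth A j = fps_nth B j"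
  shows "fps_nth F k = fps_nth G k"
proof -
  define U where "U = D_fps q A * D_fps q B"
  \<comment> \<open>The constant coefficient of \<open>D_fps q A\<close> is \<open>q\<close> times
    that of \<open>A\<close>, so \<open>U\<close> is invertible.\<close>
  have U0: "fps_nth U 0 \<noteq> 0"
    using nz by (simp add: U_def D_fps_def)
  have "(F - 1) * D_fps q A = - (fps_X * (A - 1))"
    using F N_fps_minus_D_fps[of q A] by (simp add: algebra_simps)
  moreover have "(G - 1) * D_fps q B = - (fps_X * (B - 1))"
    using G N_fps_minus_D_fps[of q B] by (simp add: algebra_simps)
  ultimately have "(F - G) * U = fps_X * ((B - 1) * D_fps q A - (A - 1) * D_fps q B)"
    unfolding U_def by algebra
  \<comment> \<open>The terms with the product \<open>A * B\<close> cancel; what remains is linear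
    in \<open>A - B\<close>.\<close>
  also have "(B - 1) * D_fps q A - (A - 1) * D_fps q B
      = (A - B) * (fps_X - fps_const q * (1 + fps_X))"
    unfolding D_fps_def by algebra
  finally have FU: "(F - G) * U = fps_X * ((A - B) * (fps_X - fps_const q * (1 + fps_X)))" .
  have "F - G = (F - G) * U * inverse U"
    using inverse_mult_eq_1'[OF U0] by (simp add: mult.assoc)
  then have FG: "F - G = fps_X * ((A - B) * ((fps_X - fps_const q * (1 + fps_X)) * inverse U))"
    unfolding FU by (simp only: mult.assoc)
  \<comment> \<open>Whatever the cofactor \<open>C\<close>, only coefficients of
    \<open>A - B\<close> with index below \<open>k\<close> enter.\<close>
  have "fps_nth (fps_X * ((A - B) * C)) k = 0" for C :: "real fps"
    using eq by (cases k) (auto simp: fps_mult_nth intro!: sum.neutral)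
  then show ?thesis
    using FG by (metis eq_iff_diff_eq_0 fps_sub_nth)
qed

subsection \<open>The law of one attempt\<close>

lemma pgf_integrable:
  fixes z :: real
  assumes "\<bar>z\<bar> \<le> 1"
  shows "integrable (measure_pmf P) (\<lambda>t. z ^ t)"
  using integrable_power_mono[of "\<lambda>t. t" "measure_pmf P" 1 z] assms by simp

lemma pgf_mono:
  assumes "0 \<le> x" "x \<le> y" "y \<le> 1"
  shows "pgf P x \<le> pgf P y"
  unfolding pgf_def
  using assms by (intro integral_mono pgf_integrable power_mono) auto

lemma pgf_nonneg: "0 \<le> z \<Longrightarrow> 0 \<le> pgf P z"
  unfolding pgf_def by simp

lemma pgf_1 [simp]: "pgf P 1 = 1"
  by (simp add: pgf_def)

text \<open>A nonnegative integrand with expectation 0 vanishes almost surely, which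
  \<open>z ^ t\<close> with positive \<open>z\<close> cannot do.\<close>

lemma pgf_pos:
  assumes "0 < z" "z \<le> 1"
  shows "0 < pgf P z"
proof -
  have "pgf P z \<noteq> 0"
    unfolding pgf_def
    using assms integral_nonneg_eq_0_iff_AE[OF pgf_integrable[of z P]] by auto
  with pgf_nonneg[of z P] assms show ?thesis by simp
qed

lemma measurable_compose_countable_nat2:
  fixes X Y :: "'a \<Rightarrow> nat"
  assumes "X \<in> measurable M (count_space UNIV)" "Y \<in> measurable M (count_space UNIV)"
  shows "(\<lambda>\<omega>. h (X \<omega>) (Y \<omega>)) \<in> measurable M (count_space UNIV)"
  by (rule measurable_compose_countable[OF measurable_compose[OF assms(2)] assms(1)]) simp

text \<open>A telescoping geometric sum, written without division so that \<open>w = 1\<close> is no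
  special case.\<close>

lemma power_min_eq_tail_sum:
  fixes w :: "'a :: comm_ring_1"
  shows "w ^ min x y = 1 + (w - 1) * (\<Sum>j<x. w ^ j * of_bool (j < y))"
proof -
  have "(\<Sum>j<x. w ^ j * of_bool (j < y)) = (\<Sum>j<min x y. w ^ j)"
    by (intro sum.mono_neutral_cong_right) auto
  then show ?thesis
    using power_diff_1_eq[of w "min x y"] by (simp add: algebra_simps)
qed

text \<open>The arguments \<open>x\<close> and \<open>y\<close> stand for the base time and the catastrophe time of an attempt.\<close>

definition success_factor :: "real \<Rightarrow> nat \<Rightarrow> nat \<Rightarrow> real" where
  "success_factor w x y = (if x < y then w ^ x else 0)"

definition failure_factor :: "real \<Rightarrow> nat \<Rightarrow> nat \<Rightarrow> real" where
  "failure_factor w x y = (if x < y then 0 else w ^ min x y)"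

lemma abs_success_factor: "\<bar>success_factor w x y\<bar> = success_factor \<bar>w\<bar> x y"
  by (simp add: success_factor_def power_abs)

lemma abs_failure_factor: "\<bar>failure_factor w x y\<bar> = failure_factor \<bar>w\<bar> x y"
  by (simp add: failure_factor_def power_abs)

text \<open>The function a(w) of the overview: the defective generating function of the length of a
  failed attempt, with total mass 1 - p at w = 1.\<close>

definition failure_pgf :: "real \<Rightarrow> nat pmf \<Rightarrow> real \<Rightarrow> real" where
  "failure_pgf q P w = w * q * (1 - pgf P (w * (1 - q))) / (1 - w * (1 - q))"

context memoryless_catastrophe
begin

lemma T0_measurable [measurable]: "T0 i \<in> measurable M (count_space UNIV)"
  using indep unfolding indep_vars_def by (auto dest: spec[of _ "Inl i"])

lemma tau_measurable [measurable]: "tau i \<in> measurable M (count_space UNIV)"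
  using indep unfolding indep_vars_def by (auto dest: spec[of _ "Inr i"])

lemma indep_T0_tau: "indep_var (count_space UNIV) (T0 i) (count_space UNIV) (tau i)"
proof -
  let ?X = "case_sum T0 tau"
  let ?N = "\<lambda>_ :: nat + nat. count_space (UNIV :: nat set)"
  have "indep_var (PiM {Inl i} ?N) (\<lambda>\<omega>. restrict (\<lambda>j. ?X j \<omega>) {Inl i})
                  (PiM {Inr i} ?N) (\<lambda>\<omega>. restrict (\<lambda>j. ?X j \<omega>) {Inr i})"
    by (rule indep_var_restrict[OF indep]) auto
  then have "indep_var (count_space UNIV) ((\<lambda>f. f (Inl i)) \<circ> (\<lambda>\<omega>. restrict (\<lambda>j. ?X j \<omega>) {Inl i}))
                  (count_space UNIV) ((\<lambda>f. f (Inr i)) \<circ> (\<lambda>\<omega>. restrict (\<lambda>j. ?X j \<omega>) {Inr i}))"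
    by (rule indep_var_compose) (auto intro: measurable_component_singleton)
  then show ?thesis
    by (simp add: comp_def)
qed

text \<open>The joint family splits into the disjoint blocks \<open>{Inl i, Inr i}\<close>, one per
  attempt. The function may vary with \<open>i\<close> because the first success is weighted
  differently from the failures before it.\<close>

lemma indep_attempts:
  fixes \<phi> :: "nat \<Rightarrow> nat \<Rightarrow> nat \<Rightarrow> real"
  shows "indep_vars (\<lambda>_. borel) (\<lambda>i \<omega>. \<phi> i (T0 i \<omega>) (tau i \<omega>)) UNIV"
proof -
  let ?X = "case_sum T0 tau"
  let ?N = "\<lambda>_ :: nat + nat. count_space (UNIV :: nat set)"
  let ?K = "\<lambda>i :: nat. {Inl i, Inr i} :: (nat + nat) set"
  have "indep_vars (\<lambda>i. PiM (?K i) ?N) (\<lambda>i \<omega>. restrict (\<lambda>j. ?X j \<omega>) (?K i)) UNIV"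
    by (rule indep_vars_restrict[OF indep]) (auto simp: disjoint_family_on_def)
  then have "indep_vars (\<lambda>_. borel)
      (\<lambda>i \<omega>. (\<lambda>f. \<phi> i (f (Inl i)) (f (Inr i))) (restrict (\<lambda>j. ?X j \<omega>) (?K i))) UNIV"
  proof (rule indep_vars_compose2)
    fix i
    have [measurable]: "(\<lambda>f. f (Inl i)) \<in> measurable (PiM (?K i) ?N) (count_space UNIV)"
      "(\<lambda>f. f (Inr i)) \<in> measurable (PiM (?K i) ?N) (count_space UNIV)"
      by (auto intro: measurable_component_singleton)
    show "(\<lambda>f. \<phi> i (f (Inl i)) (f (Inr i))) \<in> borel_measurable (PiM (?K i) ?N)"
      by measurable
  qed
  then show ?thesis by simp
qed

text \<open>Conditioning on the base time: by independence the joint law is a product, and Fubini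
  applies. The inner integral stays on \<open>M\<close>, where the tails of \<open>tau i\<close> are
  given.\<close>

lemma
  fixes \<phi> :: "nat \<Rightarrow> nat \<Rightarrow> real"
  assumes inner: "\<And>x. integrable M (\<lambda>\<omega>. \<phi> x (tau i \<omega>))"
    and outer: "integrable (measure_pmf P) (\<lambda>x. \<integral>\<omega>. \<bar>\<phi> x (tau i \<omega>)\<bar> \<partial>M)"
  shows integrable_attempt: "integrable M (\<lambda>\<omega>. \<phi> (T0 i \<omega>) (tau i \<omega>))"
    and integral_attempt: "(\<integral>\<omega>. \<phi> (T0 i \<omega>) (tau i \<omega>) \<partial>M)
      = measure_pmf.expectation P (\<lambda>x. \<integral>\<omega>. \<phi> x (tau i \<omega>) \<partial>M)"
proof -
  let ?C = "count_space (UNIV :: nat set)"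
  let ?\<nu> = "distr M ?C (tau i)"
  interpret \<nu>: prob_space ?\<nu>
    by (rule prob_space_distr) simp
  interpret pair_sigma_finite "measure_pmf P" ?\<nu> ..
  have law: "distr M (?C \<Otimes>\<^sub>M ?C) (\<lambda>\<omega>. (T0 i \<omega>, tau i \<omega>)) = measure_pmf P \<Otimes>\<^sub>M ?\<nu>"
    using indep_T0_tau[of i] unfolding indep_var_distribution_eq T0_law by simp
  have meas: "case_prod \<phi> \<in> borel_measurable (?C \<Otimes>\<^sub>M ?C)"
    by (rule measurable_pair_measure_countable1) auto
  have sets: "sets (measure_pmf P \<Otimes>\<^sub>M ?\<nu>) = sets (?C \<Otimes>\<^sub>M ?C)"
    by (intro sets_pair_measure_cong) auto
  have inner_eq: "(\<integral>y. f (\<phi> x y) \<partial>?\<nu>) = (\<integral>\<omega>. f (\<phi> x (tau i \<omega>)) \<partial>M)"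
    for x and f :: "real \<Rightarrow> real"
    by (rule integral_distr) auto
  have int: "integrable (measure_pmf P \<Otimes>\<^sub>M ?\<nu>) (case_prod \<phi>)"
  proof (rule Fubini_integrable)
    show "case_prod \<phi> \<in> borel_measurable (measure_pmf P \<Otimes>\<^sub>M ?\<nu>)"
      using meas measurable_cong_sets[OF sets refl] by blast
    show "integrable (measure_pmf P) (\<lambda>x. \<integral>y. norm (case (x, y) of (x, y) \<Rightarrow> \<phi> x y) \<partial>?\<nu>)"
      using outer by (simp add: inner_eq[of abs])
    show "AE x in measure_pmf P. integrable ?\<nu> (\<lambda>y. case (x, y) of (x, y) \<Rightarrow> \<phi> x y)"
      using inner by (simp add: integrable_distr_eq)
  qed
  have pair [measurable]: "(\<lambda>\<omega>. (T0 i \<omega>, tau i \<omega>)) \<in> measurable M (?C \<Otimes>\<^sub>M ?C)"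
    by measurable
  from int show "integrable M (\<lambda>\<omega>. \<phi> (T0 i \<omega>) (tau i \<omega>))"
    unfolding law[symmetric] by (subst (asm) integrable_distr_eq[OF pair meas]) simp
  have "(\<integral>\<omega>. \<phi> (T0 i \<omega>) (tau i \<omega>) \<partial>M) = integral\<^sup>L (measure_pmf P \<Otimes>\<^sub>M ?\<nu>) (case_prod \<phi>)"
    unfolding law[symmetric] by (subst integral_distr[OF pair meas]) simp
  also have "\<dots> = measure_pmf.expectation P (\<lambda>x. \<integral>y. \<phi> x y \<partial>?\<nu>)"
    using integral_fst'[OF int] by simp
  finally show "(\<integral>\<omega>. \<phi> (T0 i \<omega>) (tau i \<omega>) \<partial>M)
      = measure_pmf.expectation P (\<lambda>x. \<integral>\<omega>. \<phi> x (tau i \<omega>) \<partial>M)"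
    using inner_eq[of "\<lambda>x. x"] by simp
qed

lemma tau_tail_integrable: "integrable M (\<lambda>\<omega>. of_bool (j < tau i \<omega>) :: real)"
  by (rule integrable_const_bound[of _ 1]) (auto intro: measurable_compose[OF tau_measurable])

lemma tau_tail_integral: "(\<integral>\<omega>. of_bool (j < tau i \<omega>) \<partial>M) = (1 - q) ^ j"
proof -
  have "(\<integral>\<omega>. of_bool (j < tau i \<omega>) \<partial>M) = (\<integral>\<omega>. indicator {\<omega> \<in> space M. tau i \<omega> > j} \<omega> \<partial>M)"
    by (intro Bochner_Integration.integral_cong) (auto simp: indicator_def)
  also have "\<dots> = prob {\<omega> \<in> space M. tau i \<omega> > j}"
    by (subst Bochner_Integration.integral_indicator) auto
  finally show ?thesis
    by (simp add: tau_tail)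
qed

lemma
  shows success_factor_integrable_tau: "integrable M (\<lambda>\<omega>. success_factor w x (tau i \<omega>))"
    and success_factor_integral_tau:
      "(\<integral>\<omega>. success_factor w x (tau i \<omega>) \<partial>M) = (w * (1 - q)) ^ x"
proof -
  have eq: "success_factor w x y = w ^ x * of_bool (x < y)" for y
    by (simp add: success_factor_def)
  show "integrable M (\<lambda>\<omega>. success_factor w x (tau i \<omega>))"
    unfolding eq by (intro integrable_mult_right tau_tail_integrable)
  show "(\<integral>\<omega>. success_factor w x (tau i \<omega>) \<partial>M) = (w * (1 - q)) ^ x"
    unfolding eq using tau_tail_integrable[of x i]
    by (simp add: tau_tail_integral power_mult_distrib del: of_bool_eq)
qed

text \<open>Writing \<open>w ^ min x tau\<close> as a sum over tail events means that only the tails of \<open>tau\<close> enter.\<close>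

lemma
  shows failure_factor_integrable_tau: "integrable M (\<lambda>\<omega>. failure_factor w x (tau i \<omega>))"
    and failure_factor_integral_tau:
      "(\<integral>\<omega>. failure_factor w x (tau i \<omega>) \<partial>M) = w * q * (\<Sum>j<x. (w * (1 - q)) ^ j)"
proof -
  have eq: "failure_factor w x y
      = 1 + (w - 1) * (\<Sum>j<x. w ^ j * of_bool (j < y)) - success_factor w x y" for y
    using power_min_eq_tail_sum[of w x y] by (auto simp: failure_factor_def success_factor_def)
  have int: "integrable M (\<lambda>\<omega>. (w - 1) * (\<Sum>j<x. w ^ j * of_bool (j < tau i \<omega>)))"
    by (intro integrable_mult_right Bochner_Integration.integrable_sum tau_tail_integrable)
  show "integrable M (\<lambda>\<omega>. failure_factor w x (tau i \<omega>))"
    unfolding eq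
    by (intro Bochner_Integration.integrable_diff Bochner_Integration.integrable_add int
          success_factor_integrable_tau) simp
  have "(\<integral>\<omega>. failure_factor w x (tau i \<omega>) \<partial>M)
      = 1 + (w - 1) * (\<Sum>j<x. (w * (1 - q)) ^ j) - (w * (1 - q)) ^ x"
    unfolding eq using int
    by (simp del: sum_mult_of_bool_eq add: success_factor_integrable_tau success_factor_integral_tau prob_space
          tau_tail_integrable tau_tail_integral power_mult_distrib)
  \<comment> \<open>With u = w(1 - q), the difference 1 - u^x is (1 - u) times the geometric sum,
    and (w - 1) + (1 - u) = wq.\<close>
  also have "\<dots> = w * q * (\<Sum>j<x. (w * (1 - q)) ^ j)"
    using one_diff_power_eq[of "w * (1 - q)" x] by (simp add: algebra_simps)
  finally show "(\<integral>\<omega>. failure_factor w x (tau i \<omega>) \<partial>M)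
      = w * q * (\<Sum>j<x. (w * (1 - q)) ^ j)" .
qed

lemma
  assumes q: "q \<le> 1" and w: "\<bar>w\<bar> * (1 - q) < 1"
  shows success_factor_integrable: "integrable M (\<lambda>\<omega>. success_factor w (T0 i \<omega>) (tau i \<omega>))"
    and success_factor_integral:
      "(\<integral>\<omega>. success_factor w (T0 i \<omega>) (tau i \<omega>) \<partial>M) = pgf P (w * (1 - q))"
    and failure_factor_integrable: "integrable M (\<lambda>\<omega>. failure_factor w (T0 i \<omega>) (tau i \<omega>))"
    and failure_factor_integral:
      "(\<integral>\<omega>. failure_factor w (T0 i \<omega>) (tau i \<omega>) \<partial>M) = failure_pgf q P w"
proof -
  \<comment> \<open>Needed both for \<open>w\<close>, to evaluate the integrals, and for
    \<open>\<bar>w\<bar>\<close>, since the absolute values of the factors are the factors at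
    \<open>\<bar>w\<bar>\<close>.\<close>
  have u: "\<bar>v * (1 - q)\<bar> < 1" if "\<bar>v\<bar> = \<bar>w\<bar>" for v
    using q w that by (simp add: abs_mult)
  have S: "integrable (measure_pmf P) (\<lambda>x. \<integral>\<omega>. \<bar>success_factor w x (tau i \<omega>)\<bar> \<partial>M)"
    unfolding abs_success_factor success_factor_integral_tau
    using u[of "\<bar>w\<bar>"] by (intro pgf_integrable) auto
  show "integrable M (\<lambda>\<omega>. success_factor w (T0 i \<omega>) (tau i \<omega>))"
    using success_factor_integrable_tau S by (rule integrable_attempt)
  show "(\<integral>\<omega>. success_factor w (T0 i \<omega>) (tau i \<omega>) \<partial>M) = pgf P (w * (1 - q))"
    unfolding pgf_def
    by (subst integral_attempt[OF success_factor_integrable_tau S])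
       (simp add: success_factor_integral_tau)
  have sum_eq: "v * q * (\<Sum>j<x. (v * (1 - q)) ^ j)
      = v * q / (1 - v * (1 - q)) * (1 - (v * (1 - q)) ^ x)" if "\<bar>v\<bar> = \<bar>w\<bar>" for v x
    using u[OF that] one_diff_power_eq[of "v * (1 - q)" x] by auto
  have F: "integrable (measure_pmf P) (\<lambda>x. \<integral>\<omega>. \<bar>failure_factor w x (tau i \<omega>)\<bar> \<partial>M)"
    unfolding abs_failure_factor failure_factor_integral_tau sum_eq[of "\<bar>w\<bar>", OF abs_idempotent]
    using u[OF abs_idempotent]
    by (intro integrable_mult_right Bochner_Integration.integrable_diff pgf_integrable) auto
  show "integrable M (\<lambda>\<omega>. failure_factor w (T0 i \<omega>) (tau i \<omega>))"
    using failure_factor_integrable_tau F by (rule integrable_attempt)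
  have "(\<integral>\<omega>. failure_factor w (T0 i \<omega>) (tau i \<omega>) \<partial>M)
      = measure_pmf.expectation P (\<lambda>x. w * q / (1 - w * (1 - q)) * (1 - (w * (1 - q)) ^ x))"
    by (subst integral_attempt[OF failure_factor_integrable_tau F])
       (simp only: failure_factor_integral_tau sum_eq[of w, OF refl])
  also have "\<dots> = w * q / (1 - w * (1 - q)) * (1 - pgf P (w * (1 - q)))"
    unfolding pgf_def using u[of w] by (simp add: pgf_integrable)
  finally show "(\<integral>\<omega>. failure_factor w (T0 i \<omega>) (tau i \<omega>) \<partial>M) = failure_pgf q P w"
    by (simp add: failure_pgf_def)
qed

subsection \<open>The generating function of the completion time\<close>

text \<open>This is \<open>w\<close> to the completion time, restricted to the event that attempt
  \<open>n\<close> is the first success. The product form lets independence factor its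
  expectation.\<close>

definition first_success_term :: "real \<Rightarrow> nat \<Rightarrow> 'a \<Rightarrow> real" where
  "first_success_term w n \<omega> =
     (\<Prod>i\<le>n. (if i = n then success_factor w else failure_factor w) (T0 i \<omega>) (tau i \<omega>))"

lemma abs_first_success_term:
  "\<bar>first_success_term w n \<omega>\<bar> = first_success_term \<bar>w\<bar> n \<omega>"
  unfolding first_success_term_def abs_prod
  by (intro prod.cong) (auto simp: abs_success_factor abs_failure_factor)

lemma
  assumes "q \<le> 1" "\<bar>w\<bar> * (1 - q) < 1"
  shows first_success_term_integrable: "integrable M (first_success_term w n)"
    and first_success_term_integral:
      "(\<integral>\<omega>. first_success_term w n \<omega> \<partial>M) = failure_pgf q P w ^ n * pgf P (w * (1 - q))"
proof -
  let ?\<phi> = "\<lambda>i. if i = n then success_factor w else failure_factor w"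
  have ind: "indep_vars (\<lambda>_. borel) (\<lambda>i \<omega>. ?\<phi> i (T0 i \<omega>) (tau i \<omega>)) {..n}"
    using indep_attempts by (rule indep_vars_subset) simp
  have int: "integrable M (\<lambda>\<omega>. ?\<phi> i (T0 i \<omega>) (tau i \<omega>))" for i
    using assms by (auto intro: success_factor_integrable failure_factor_integrable)
  show "integrable M (first_success_term w n)"
    unfolding first_success_term_def[abs_def] by (rule indep_vars_integrable[OF _ ind int]) simp
  have "(\<integral>\<omega>. first_success_term w n \<omega> \<partial>M) = (\<Prod>i\<le>n. \<integral>\<omega>. ?\<phi> i (T0 i \<omega>) (tau i \<omega>) \<partial>M)"
    unfolding first_success_term_def[abs_def]
    by (rule indep_vars_lebesgue_integral[OF _ ind int]) simp
  also have "\<dots> = (\<Prod>i<n. failure_pgf q P w) * pgf P (w * (1 - q))"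
    unfolding lessThan_Suc_atMost[symmetric] prod.lessThan_Suc
    using success_factor_integral[OF assms] failure_factor_integral[OF assms]
    by (intro arg_cong2[where f = "(*)"] prod.cong) auto
  finally show "(\<integral>\<omega>. first_success_term w n \<omega> \<partial>M)
      = failure_pgf q P w ^ n * pgf P (w * (1 - q))"
    by simp
qed

lemma first_success_term_eq:
  "first_success_term w n \<omega> =
     (if (\<forall>i<n. \<not> T0 i \<omega> < tau i \<omega>) \<and> T0 n \<omega> < tau n \<omega>
      then w ^ completion_time T0 tau \<omega> else 0)"
proof (cases "(\<forall>i<n. \<not> T0 i \<omega> < tau i \<omega>) \<and> T0 n \<omega> < tau n \<omega>")
  case True
  then have least: "(LEAST i. T0 i \<omega> < tau i \<omega>) = n"
    by (intro Least_equality) (auto simp: not_le[symmetric])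
  have "w ^ completion_time T0 tau \<omega> = (\<Prod>i\<le>n. w ^ min (T0 i \<omega>) (tau i \<omega>))"
    using True unfolding completion_time_def least by (auto simp: power_sum)
  also have "\<dots> = first_success_term w n \<omega>"
    unfolding first_success_term_def using True
    by (intro prod.cong) (auto simp: success_factor_def failure_factor_def)
  finally show ?thesis
    using True by simp
next
  case False
  then consider i where "i < n" "T0 i \<omega> < tau i \<omega>" | "\<not> T0 n \<omega> < tau n \<omega>"
    by blast
  then have "\<exists>i\<le>n. (if i = n then success_factor w else failure_factor w) (T0 i \<omega>) (tau i \<omega>) = 0"
  proof cases
    case 1
    then show ?thesis by (intro exI[of _ i]) (simp add: failure_factor_def)
  next
    case 2
    then show ?thesis by (intro exI[of _ n]) (simp add: success_factor_def)
  qed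
  then have "first_success_term w n \<omega> = 0"
    unfolding first_success_term_def by (intro prod_zero finite_atMost) (simp only: Bex_def atMost_iff)
  with False show ?thesis
    by auto
qed

text \<open>At most one term is nonzero. Without any success all terms vanish, whereas the
  convention for \<open>completion_time\<close> would give \<open>w ^ 0 = 1\<close>; hence the
  conditional, which \<open>AE_success\<close> later removes.\<close>

lemma first_success_term_sums:
  "(\<lambda>n. first_success_term w n \<omega>) sums
     (if \<exists>i. T0 i \<omega> < tau i \<omega> then w ^ completion_time T0 tau \<omega> else 0)"
proof (cases "\<exists>i. T0 i \<omega> < tau i \<omega>")
  case True
  define n where "n = (LEAST i. T0 i \<omega> < tau i \<omega>)"
  have n: "T0 n \<omega> < tau n \<omega>"
    unfolding n_def using True by (rule LeastI_ex)
  have n': "\<forall>i<n. \<not> T0 i \<omega> < tau i \<omega>"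
    unfolding n_def by (intro allI impI not_less_Least)
  have "first_success_term w m \<omega> = (if m = n then w ^ completion_time T0 tau \<omega> else 0)" for m
    unfolding first_success_term_eq using n n' by (cases m n rule: linorder_cases) auto
  with True sums_single[of n "\<lambda>_. w ^ completion_time T0 tau \<omega>"] show ?thesis
    by simp
qed (simp add: first_success_term_eq)

text \<open>The norms of the terms are the terms at \<open>\<bar>w\<bar>\<close>, whose expectations
  form a geometric series of ratio \<open>failure_pgf q P \<bar>w\<bar>\<close>. This justifies
  integrating termwise, and the triangle inequality bounds the ratio at \<open>w\<close>.\<close>

lemma
  assumes q: "q \<le> 1" and w: "\<bar>w\<bar> * (1 - q) < 1" and a: "failure_pgf q P \<bar>w\<bar> < 1"
  shows integrable_power_on_success: "integrable M
      (\<lambda>\<omega>. if \<exists>i. T0 i \<omega> < tau i \<omega> then w ^ completion_time T0 tau \<omega> else 0)" (is ?int)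
    and integral_power_on_success:
      "(\<integral>\<omega>. (if \<exists>i. T0 i \<omega> < tau i \<omega> then w ^ completion_time T0 tau \<omega> else 0) \<partial>M)
         = pgf P (w * (1 - q)) / (1 - failure_pgf q P w)" (is ?eq)
    and failure_pgf_less_1: "\<bar>failure_pgf q P w\<bar> < 1" (is ?less)
proof -
  have w': "\<bar>\<bar>w\<bar>\<bar> * (1 - q) < 1"
    using w by simp
  have "\<bar>failure_pgf q P w\<bar> \<le> failure_pgf q P \<bar>w\<bar>"
    using integral_abs_bound[of M "\<lambda>\<omega>. failure_factor w (T0 0 \<omega>) (tau 0 \<omega>)"]
      failure_factor_integral[OF q w] failure_factor_integral[OF q w']
    by (simp add: abs_failure_factor)
  with a show ?less
    by simp
  from \<open>\<bar>failure_pgf q P w\<bar> \<le> failure_pgf q P \<bar>w\<bar>\<close> a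
  have a': "norm (failure_pgf q P \<bar>w\<bar>) < 1"
    by simp
  have sum: "(\<Sum>n. first_success_term w n \<omega>)
      = (if \<exists>i. T0 i \<omega> < tau i \<omega> then w ^ completion_time T0 tau \<omega> else 0)" for \<omega>
    using first_success_term_sums by (rule sums_unique[symmetric])
  have abs_summable: "AE \<omega> in M. summable (\<lambda>n. norm (first_success_term w n \<omega>))"
    unfolding real_norm_def abs_first_success_term
    using first_success_term_sums by (intro AE_I2 sums_summable)
  have "summable (\<lambda>n. failure_pgf q P \<bar>w\<bar> ^ n * pgf P (\<bar>w\<bar> * (1 - q)))"
    using a' by (intro summable_mult2 summable_geometric)
  then have int_summable: "summable (\<lambda>n. \<integral>\<omega>. norm (first_success_term w n \<omega>) \<partial>M)"
    unfolding real_norm_def abs_first_success_term first_success_term_integral[OF q w'] .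
  note int = first_success_term_integrable[OF q w]
  show ?int
    using integrable_suminf[OF int abs_summable int_summable] unfolding sum .
  have "(\<lambda>n. failure_pgf q P w ^ n * pgf P (w * (1 - q))) sums
      (\<integral>\<omega>. (if \<exists>i. T0 i \<omega> < tau i \<omega> then w ^ completion_time T0 tau \<omega> else 0) \<partial>M)"
    using sums_integral[OF int abs_summable int_summable]
    unfolding sum first_success_term_integral[OF q w] .
  moreover have "(\<lambda>n. failure_pgf q P w ^ n * pgf P (w * (1 - q))) sums
      (1 / (1 - failure_pgf q P w) * pgf P (w * (1 - q)))"
    using \<open>?less\<close> by (intro sums_mult2 geometric_sums) simp
  ultimately show ?eq
    by (auto dest: sums_unique2)
qed

lemma success_measurable [measurable]: "Measurable.pred M (\<lambda>\<omega>. T0 i \<omega> < tau i \<omega>)"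
  by (rule measurable_compose_countable_nat2) simp_all

lemma completion_time_measurable:
  "completion_time T0 tau \<in> measurable M (count_space UNIV)"
proof -
  note comp = measurable_compose_countable_nat2
  have total: "(\<lambda>\<omega>. \<Sum>i\<le>n. min (T0 i \<omega>) (tau i \<omega>)) \<in> measurable M (count_space UNIV)" for n
    by (induction n) (auto intro!: comp[where h = min] comp[where h = "(+)"])
  have "(\<lambda>\<omega>. LEAST i. T0 i \<omega> < tau i \<omega>) \<in> measurable M (count_space UNIV)"
    by measurable
  then show ?thesis
    unfolding completion_time_def[abs_def]
    by (intro measurable_If measurable_compose_countable[OF total]) auto
qed

section \<open>Almost sure success, a disc of radius larger than 1, and factorial moments\<close>

context
  assumes q: "0 < q" "q < 1"
begin

lemma success_prob: "0 < pgf P (1 - q)" "pgf P (1 - q) \<le> 1"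
  using pgf_pos[of "1 - q" P] pgf_mono[of "1 - q" 1 P] q by simp_all

lemma radius_imp_base_bound:
  assumes "\<bar>w\<bar> * (1 - q * pgf P (1 - q)) < 1"
  shows "\<bar>w\<bar> * (1 - q) < 1"
proof -
  have "q * pgf P (1 - q) \<le> q * 1"
    using success_prob q by (intro mult_left_mono) auto
  then have "\<bar>w\<bar> * (1 - q) \<le> \<bar>w\<bar> * (1 - q * pgf P (1 - q))"
    by (intro mult_left_mono) auto
  with assms show ?thesis by simp
qed

text \<open>For r = \<open>\<bar>w\<bar>\<close> the claim amounts to r(1 - q g(rs)) < 1. If r < 1,
  nonnegativity of g suffices; otherwise g(rs) is at least p by monotonicity, and the hypothesis
  applies.\<close>

lemma failure_pgf_abs_less_1:
  assumes w: "\<bar>w\<bar> * (1 - q * pgf P (1 - q)) < 1"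
  shows "failure_pgf q P \<bar>w\<bar> < 1"
proof -
  define r where "r = \<bar>w\<bar>"
  have r: "0 \<le> r" "r * (1 - q) < 1" "r * (1 - q * pgf P (1 - q)) < 1"
    using radius_imp_base_bound[OF w] w by (simp_all add: r_def)
  have "r * q * (1 - pgf P (r * (1 - q))) < 1 - r * (1 - q)"
  proof (cases "r < 1")
    case True
    have "r * q * (1 - pgf P (r * (1 - q))) \<le> r * q * 1"
      using r q pgf_nonneg[of "r * (1 - q)" P] by (intro mult_left_mono) auto
    with True show ?thesis by (simp add: algebra_simps)
  next
    case False
    have "pgf P (1 - q) \<le> pgf P (r * (1 - q))"
      using False r q by (intro pgf_mono) auto
    then have "r * q * (1 - pgf P (r * (1 - q))) \<le> r * q * (1 - pgf P (1 - q))"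
      using r q by (intro mult_left_mono) auto
    with r show ?thesis by (simp add: algebra_simps)
  qed
  then show ?thesis
    using r unfolding failure_pgf_def r_def[symmetric] by (simp add: divide_simps)
qed

text \<open>At w = 1 the integrand of \<open>integral_power_on_success\<close> is the indicator of
  success, and its integral is p / (1 - (1 - p)) = 1.\<close>

lemma AE_success: "AE \<omega> in M. \<exists>i. T0 i \<omega> < tau i \<omega>"
proof -
  have "\<bar>1\<bar> * (1 - q * pgf P (1 - q)) < 1"
    using success_prob q by simp
  note a = failure_pgf_abs_less_1[OF this] and w = radius_imp_base_bound[OF this]
  have "failure_pgf q P 1 = 1 - pgf P (1 - q)"
    using q by (simp add: failure_pgf_def)
  then have "(\<integral>\<omega>. (if \<exists>i. T0 i \<omega> < tau i \<omega> then 1 else 0) \<partial>M) = (1 :: real)"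
    using integral_power_on_success[OF _ w a] q success_prob by (simp only: power_one) simp
  moreover have "(\<integral>\<omega>. (if \<exists>i. T0 i \<omega> < tau i \<omega> then 1 else 0) \<partial>M)
      = prob {\<omega> \<in> space M. \<exists>i. T0 i \<omega> < tau i \<omega>}"
  proof -
    have "(\<integral>\<omega>. (if \<exists>i. T0 i \<omega> < tau i \<omega> then 1 else 0) \<partial>M)
        = (\<integral>\<omega>. indicator {\<omega> \<in> space M. \<exists>i. T0 i \<omega> < tau i \<omega>} \<omega> \<partial>M)"
      by (intro Bochner_Integration.integral_cong) (auto simp: indicator_def)
    also have "\<dots> = prob {\<omega> \<in> space M. \<exists>i. T0 i \<omega> < tau i \<omega>}"
      by (auto intro!: arg_cong[where f = prob])
    finally show ?thesis .
  qed
  moreover have "{\<omega> \<in> space M. \<exists>i. T0 i \<omega> < tau i \<omega>} \<in> events"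
    by measurable
  ultimately show ?thesis
    by (simp add: prob_Collect_eq_1)
qed

lemma
  assumes w: "\<bar>w\<bar> * (1 - q * pgf P (1 - q)) < 1"
  shows completion_time_power_integrable: "integrable M (\<lambda>\<omega>. w ^ completion_time T0 tau \<omega>)"
    and completion_time_pgf:
      "(\<integral>\<omega>. w ^ completion_time T0 tau \<omega> \<partial>M) = N_fun q P w / D_fun q P w"
    and D_fun_nonzero: "D_fun q P w \<noteq> 0"
proof -
  let ?f = "\<lambda>\<omega>. if \<exists>i. T0 i \<omega> < tau i \<omega> then w ^ completion_time T0 tau \<omega> else 0"
  have q': "q \<le> 1" using q by simp
  note hyps = q' radius_imp_base_bound[OF w] failure_pgf_abs_less_1[OF w]
  have ae: "AE \<omega> in M. ?f \<omega> = w ^ completion_time T0 tau \<omega>"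
    using AE_success by eventually_elim simp
  have meas: "(\<lambda>\<omega>. w ^ completion_time T0 tau \<omega>) \<in> borel_measurable M"
    by (rule measurable_compose[OF completion_time_measurable]) simp
  have int: "integrable M ?f"
    using hyps by (rule integrable_power_on_success)
  show "integrable M (\<lambda>\<omega>. w ^ completion_time T0 tau \<omega>)"
    by (rule integrable_cong_AE_imp[OF int meas ae])
  have "\<bar>w * (1 - q)\<bar> < 1"
    using hyps(2) q' by (simp add: abs_mult)
  then have u: "1 - w * (1 - q) \<noteq> 0"
    by auto
  then have "(1 - w * (1 - q)) * failure_pgf q P w = w * q * (1 - pgf P (w * (1 - q)))"
    by (simp add: failure_pgf_def)
  \<comment> \<open>This factorization shows that D does not vanish and that N/D is g(ws) / (1 -
    a(w)) after cancelling 1 - ws.\<close>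
  then have D: "D_fun q P w = (1 - w * (1 - q)) * (1 - failure_pgf q P w)"
    unfolding D_fun_def by (simp only: right_diff_distrib) (simp add: algebra_simps)
  then show "D_fun q P w \<noteq> 0"
    using u failure_pgf_less_1[OF hyps] by auto
  have "(\<integral>\<omega>. w ^ completion_time T0 tau \<omega> \<partial>M) = integral\<^sup>L M ?f"
    by (rule integral_cong_AE[OF meas]) (use int ae in auto)
  also have "\<dots> = pgf P (w * (1 - q)) / (1 - failure_pgf q P w)"
    using hyps by (rule integral_power_on_success)
  also have "\<dots> = N_fun q P w / D_fun q P w"
    using u by (simp add: D N_fun_def)
  finally show "(\<integral>\<omega>. w ^ completion_time T0 tau \<omega> \<partial>M) = N_fun q P w / D_fun q P w" .
qed

lemma unit_disc_in_radius:
  assumes "\<bar>w\<bar> \<le> 1"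
  shows "\<bar>w\<bar> * (1 - q * pgf P (1 - q)) < 1"
proof -
  have p: "0 < q * pgf P (1 - q)" "q * pgf P (1 - q) \<le> 1 * 1"
    using success_prob q by (simp, intro mult_mono) auto
  then have "\<bar>w\<bar> * (1 - q * pgf P (1 - q)) \<le> 1 * (1 - q * pgf P (1 - q))"
    using assms by (intro mult_right_mono) auto
  with p show ?thesis by simp
qed

text \<open>Since qp > 0, the strict inequality holds at radius 1 and persists slightly to the right
  of it by continuity. The room beyond 1 permits the expansion about w = 1.\<close>

lemma radius_gt_1:
  obtains R where "1 < R" "integrable M (\<lambda>\<omega>. R ^ completion_time T0 tau \<omega>)"
    "\<And>w. \<bar>w\<bar> \<le> R \<Longrightarrow> \<bar>w\<bar> * (1 - q * pgf P (1 - q)) < 1"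
proof -
  let ?c = "1 - q * pgf P (1 - q)"
  have c: "0 \<le> ?c" "?c < 1"
    using success_prob q mult_le_one[of q "pgf P (1 - q)"] by auto
  have "((\<lambda>R. R * ?c) \<longlongrightarrow> 1 * ?c) (at_right 1)"
    by (intro tendsto_intros)
  then have "\<forall>\<^sub>F R in at_right 1. R * ?c < 1"
    using c by (intro order_tendstoD) auto
  then have "\<forall>\<^sub>F R in at_right (1 :: real). 1 < R \<and> R * ?c < 1"
    using eventually_at_right_less[of "1 :: real"] by eventually_elim simp
  then obtain R where R: "1 < R" "R * ?c < 1"
    using eventually_happens trivial_limit_at_right_real by blast
  have "\<bar>w\<bar> * ?c < 1" if "\<bar>w\<bar> \<le> R" for w
    using mult_right_mono[OF that c(1)] R by simp
  with R show ?thesis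
    by (intro that[of R] completion_time_power_integrable) auto
qed

text \<open>The Taylor series of G(w) in powers of w - 1.\<close>

definition completion_fps :: "real fps" where
  "completion_fps = Abs_fps (\<lambda>k. \<integral>\<omega>. real (completion_time T0 tau \<omega> choose k) \<partial>M)"

lemma completion_time_binomial_integrable:
  "integrable M (\<lambda>\<omega>. real (completion_time T0 tau \<omega> choose k))"
proof -
  obtain R where R: "1 < R" "integrable M (\<lambda>\<omega>. R ^ completion_time T0 tau \<omega>)"
    "\<And>w. \<bar>w\<bar> \<le> R \<Longrightarrow> \<bar>w\<bar> * (1 - q * pgf P (1 - q)) < 1"
    by (rule radius_gt_1) blast
  have "integrable M (\<lambda>\<omega>. real (completion_time T0 tau \<omega> choose k)
      * 1 ^ (completion_time T0 tau \<omega> - k))"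
    using R(1) by (intro integrable_binomial[OF completion_time_measurable R(2)]) simp_all
  then show ?thesis
    by (simp only: power_one mult_1_right)
qed

text \<open>The identity G D = N holds for all w near 1, and uniqueness of expansions transfers it
  to formal series without formal division.\<close>

lemma completion_fps_eq:
  "completion_fps * D_fps q (pgf_fps P (1 - q)) = N_fps q (pgf_fps P (1 - q))"
proof -
  let ?G = "\<lambda>x. \<integral>\<omega>. (1 + x) ^ completion_time T0 tau \<omega> \<partial>M"
  let ?A = "pgf_fps P (1 - q)"
  obtain R where R: "1 < R" "integrable M (\<lambda>\<omega>. R ^ completion_time T0 tau \<omega>)"
    "\<And>w. \<bar>w\<bar> \<le> R \<Longrightarrow> \<bar>w\<bar> * (1 - q * pgf P (1 - q)) < 1"
    by (rule radius_gt_1) blast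
  have "?G has_fps_expansion completion_fps"
    unfolding completion_fps_def
    using integral_power_has_fps_expansion[OF completion_time_measurable R(2), of 1 1] R(1) by simp
  then have GD: "(\<lambda>x. ?G x * D_fun q P (1 + x)) has_fps_expansion completion_fps * D_fps q ?A"
    using D_fun_has_fps_expansion[OF q] by (rule has_fps_expansion_mult)
  have "((\<lambda>x :: real. \<bar>1 + x\<bar>) \<longlongrightarrow> \<bar>1 + 0\<bar>) (nhds 0)"
    by (intro tendsto_intros filterlim_ident)
  then have "\<forall>\<^sub>F x in nhds (0 :: real). \<bar>1 + x\<bar> < R"
    using R(1) by (intro order_tendstoD) auto
  then have "\<forall>\<^sub>F x in nhds 0. ?G x * D_fun q P (1 + x) = N_fun q P (1 + x)"
  proof eventually_elim
    case (elim x)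
    then have "\<bar>1 + x\<bar> * (1 - q * pgf P (1 - q)) < 1"
      by (intro R(3)) simp
    then show ?case
      using completion_time_pgf D_fun_nonzero by simp
  qed
  then have "(\<lambda>x. N_fun q P (1 + x)) has_fps_expansion completion_fps * D_fps q ?A"
    using GD unfolding has_fps_expansion_def
    by (auto elim: eventually_elim2)
  then show ?thesis
    using N_fun_has_fps_expansion[OF q] by (rule has_fps_expansion_unique)
qed

lemma factorial_moment_eq:
  "(\<integral>\<omega>. falling_factorial k (completion_time T0 tau \<omega>) \<partial>M) = fact k * fps_nth completion_fps k"
  by (simp add: falling_factorial_eq completion_fps_def)

end

end

theorem theorem1p1:
  fixes q s :: real
    and P :: "nat pmf"
    and M :: "'a measure"
    and T0 tau :: "nat \<Rightarrow> 'a \<Rightarrow> nat"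
  assumes "0 < q" and "q < 1" and "s = 1 - q"
    and "0 \<notin> set_pmf P"
    and "memoryless_catastrophe M q P T0 tau"
  shows
    "(\<forall>w::real. \<bar>w\<bar> \<le> 1 \<longrightarrow>
        D_fun q P w \<noteq> 0 \<and>
        (\<integral>\<omega>. w ^ completion_time T0 tau \<omega> \<partial>M) = N_fun q P w / D_fun q P w) \<and>
     (\<forall>k\<ge>1. Delta q P k =
        (if k = 1 then 1 - pgf P s
         else - real k * s ^ (k - 1) * (deriv ^^ (k - 1)) (pgf P) s)) \<and>
     (\<forall>k\<ge>1. integrable M (\<lambda>\<omega>. falling_factorial k (completion_time T0 tau \<omega>))) \<and>
     (\<forall>k\<ge>1. \<forall>(P' :: nat pmf) (M' :: 'b measure) T0' tau'.
        0 \<notin> set_pmf P' \<longrightarrow>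
        memoryless_catastrophe M' q P' T0' tau' \<longrightarrow>
        same_jet (k - 1) s (pgf P) (pgf P') \<longrightarrow>
        Delta q P k = Delta q P' k \<and>
        (\<integral>\<omega>. falling_factorial k (completion_time T0 tau \<omega>) \<partial>M) =
        (\<integral>\<omega>. falling_factorial k (completion_time T0' tau' \<omega>) \<partial>M'))"
proof (intro conjI allI impI)
  note q = assms(1,2)
  interpret memoryless_catastrophe M q P T0 tau by fact
  show "D_fun q P w \<noteq> 0" if "\<bar>w\<bar> \<le> 1" for w
    using q unit_disc_in_radius[OF q that] by (rule D_fun_nonzero)
  show "(\<integral>\<omega>. w ^ completion_time T0 tau \<omega> \<partial>M) = N_fun q P w / D_fun q P w" if "\<bar>w\<bar> \<le> 1" for w
    using q unit_disc_in_radius[OF q that] by (rule completion_time_pgf)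
  show "Delta q P k = (if k = 1 then 1 - pgf P s
      else - real k * s ^ (k - 1) * (deriv ^^ (k - 1)) (pgf P) s)" if "1 \<le> k" for k
    using q that unfolding \<open>s = 1 - q\<close> by (rule Delta_eq)
  show "integrable M (\<lambda>\<omega>. falling_factorial k (completion_time T0 tau \<omega>))" for k
    unfolding falling_factorial_eq
    by (intro integrable_mult_right completion_time_binomial_integrable q)
  fix k :: nat and P' :: "nat pmf" and M' :: "'b measure" and T0' tau'
  assume k: "1 \<le> k" and M': "memoryless_catastrophe M' q P' T0' tau'"
    and "same_jet (k - 1) s (pgf P) (pgf P')"
  then have jet: "(deriv ^^ j) (pgf P) (1 - q) = (deriv ^^ j) (pgf P') (1 - q)" if "j < k" for j
    using that by (auto simp: same_jet_def \<open>s = 1 - q\<close>)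
  interpret M': memoryless_catastrophe M' q P' T0' tau' by fact
  show "Delta q P k = Delta q P' k"
    \<comment> \<open>Order 0 serves \<open>k = 1\<close>, order \<open>k - 1\<close> the other
      cases.\<close>
    unfolding Delta_eq[OF q k] using jet[of 0] jet[of "k - 1"] k by simp
  have "fps_nth completion_fps k = fps_nth M'.completion_fps k"
  proof (rule quotient_fps_nth_cong)
    show "completion_fps * D_fps q (pgf_fps P (1 - q)) = N_fps q (pgf_fps P (1 - q))"
      using q by (rule completion_fps_eq)
    show "M'.completion_fps * D_fps q (pgf_fps P' (1 - q)) = N_fps q (pgf_fps P' (1 - q))"
      using q by (rule M'.completion_fps_eq)
    show "fps_nth (pgf_fps P (1 - q)) 0 \<noteq> 0" "fps_nth (pgf_fps P' (1 - q)) 0 \<noteq> 0"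
      using success_prob[OF q] M'.success_prob[OF q] by (simp_all add: pgf_fps_def)
    show "fps_nth (pgf_fps P (1 - q)) j = fps_nth (pgf_fps P' (1 - q)) j" if "j < k" for j
      using jet[OF that] by (simp add: pgf_fps_def)
  qed (use q in simp)
  then show "(\<integral>\<omega>. falling_factorial k (completion_time T0 tau \<omega>) \<partial>M) =
      (\<integral>\<omega>. falling_factorial k (completion_time T0' tau' \<omega>) \<partial>M')"
    using factorial_moment_eq[OF q] M'.factorial_moment_eq[OF q] by simp
qed

end
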